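(* Let $G_r$ be the group generated by $\sigma_1,\dots,\sigma_5$ and $\tau$, which is isomorphic to $\mathfrak{S}_6\times\mathfrak{S}_2$, and let $H_r$ be the subgroup of $G_r$ generated by $\sigma_1,\sigma_2,\sigma_4,\sigma_5$, which is isomorphic to a direct product of two copies of $\mathfrak{S}_3$. The representatives of the orbits in the double coset decomposition $H_r\backslash G_r/H_r$ are given by $$\omega_0=\mathrm{id},\qquad \omega_1=\sigma_3,\qquad \omega_2=\sigma_3\sigma_4\sigma_2\,\omega_1=\sigma_3\sigma_4\sigma_2\sigma_3,$$ $$\omega_3=\sigma_3\sigma_4\sigma_5\sigma_2\sigma_1\,\omega_2=\sigma_3\sigma_4\sigma_5\sigma_2\sigma_1\sigma_3\sigma_4\sigma_2\sigma_3 .$$ Since $\tau$ commutes with $\sigma_i$ for all $i=1,2,3,4,5$, it also commutes with all the representatives $\omega_i$, $i=0,1,2,3$.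
   Context: $\mathfrak{S}_k$ denotes the symmetric group of degree $k$. Let $n\ge 2$, $m_1,\dots,m_n\in\mathbb{N}$ and $|M|=m_1+\dots+m_n$. The elements are transformations of the parameters $(s,c_0,c_1,c_2,d_0,d_1,d_2)$, with $\delta$ a fixed constant, and of the variables $x_1,\dots,x_n$. They are defined as follows. - $\sigma_2$ and $\sigma_1$ are the permutations $c_0\leftrightarrow c_1$ and $c_1\leftrightarrow c_2$, respectively. - $\sigma_4$ and $\sigma_5$ are the permutations $d_0\leftrightarrow d_1$ and $d_1\leftrightarrow d_2$, respectively. - $\sigma_3$ sends $(s,c_0,c_1,c_2,d_0,d_1,d_2)$ to $(2s+\delta-c_0-d_1-d_2,\ s+\delta-d_1-d_2,\ c_1,\ c_2,\ d_0,\ s+\delta-c_0-d_2,\ s+\delta-c_0-d_1)$. - $\tau$ sends $(s,c_0,c_1,c_2,d_0,d_1,d_2)$ to $(2s+\delta-c_0-c_1-c_2,\ s+\delta-c_1-c_2,\ s+\delta-c_0-c_2,\ s+\delta-c_0-c_1,\ d_0,\ d_1,\ d_2)$ and $x_i$ to $(|M|-m_i)\delta-x_i$. The $\sigma_i$ leave the variables $x_i$ fixed. They satisfy $\sigma_i^2=\mathrm{id}$, $\sigma_i\sigma_{i+1}\sigma_i=\sigma_{i+1}\sigma_i\sigma_{i+1}$, and $\sigma_i\sigma_j=\sigma_j\sigma_i$ for $|i-j|\ge 2$. They generate $\mathfrak{S}_6$, and $\tau$, with $\tau^2=\mathrm{id}$, generates $\mathfrak{S}_2$. The group $G_r$ describes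 the symmetry of the $A_n$ elliptic hypergeometric series of rectangular type (that is, terminating with respect to a multi-index) with numerator parameters $c_0,c_1,c_2$ and $d_0,d_1,d_2$, under the balancing condition $(c_0+c_1+c_2)+(d_0+d_1+d_2)=(2+|M|)\delta+3s$. The subgroup $H_r$ corresponds to the permutations within $\{c_0,c_1,c_2\}$ and within $\{d_0,d_1,d_2\}$.
   Formalization: As worded, the four ω_i do not represent all double cosets in H_r\G_r/H_r (there are eight; τ lies in none of the four H_r ω_i H_r); the formal theorem shows that they represent the orbits of τ on the double cosets, and that the ω_i and ω_i τ represent all eight. *)

theory Defs
  imports
    "HOL-Analysis.Finite_Cartesian_Product"
    "HOL-Algebra.Sym_Groups"
    "HOL-Algebra.Generated_Groups"
    "HOL-Algebra.Group_Action"
begin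

text \<open>
  A point is \<open>(s, c0, c1, c2, d0, d1, d2, x)\<close> with \<open>x = (x_1, ..., x_n)\<close>, where \<open>n = CARD('n)\<close>.
  All eight entries are free complex variables. The balancing condition is preserved by the
  transformations, but it is not imposed.
\<close>

type_synonym 'n point =
  "complex \<times> complex \<times> complex \<times> complex \<times> complex \<times> complex \<times> complex \<times> (complex ^ 'n)"

text \<open>Only the indices \<open>1, ..., 5\<close> are meaningful.\<close>

definition sigma :: "complex \<Rightarrow> nat \<Rightarrow> 'n::finite point \<Rightarrow> 'n point" where
  "sigma \<delta> i = (\<lambda>(s, c0, c1, c2, d0, d1, d2, x).
     if i = 1 then (s, c0, c2, c1, d0, d1, d2, x)
     else if i = 2 then (s, c1, c0, c2, d0, d1, d2, x)
     else if i = 3 then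
       (2 * s + \<delta> - c0 - d1 - d2,
        s + \<delta> - d1 - d2, c1, c2,
        d0, s + \<delta> - c0 - d2, s + \<delta> - c0 - d1, x)
     else if i = 4 then (s, c0, c1, c2, d1, d0, d2, x)
     else if i = 5 then (s, c0, c1, c2, d0, d2, d1, x)
     else (s, c0, c1, c2, d0, d1, d2, x))"

definition tau :: "complex \<Rightarrow> ('n \<Rightarrow> nat) \<Rightarrow> 'n::finite point \<Rightarrow> 'n point" where
  "tau \<delta> m = (\<lambda>(s, c0, c1, c2, d0, d1, d2, x).
     (2 * s + \<delta> - c0 - c1 - c2,
      s + \<delta> - c1 - c2, s + \<delta> - c0 - c2, s + \<delta> - c0 - c1,
      d0, d1, d2,
      \<chi> i. (of_nat (\<Sum>j\<in>UNIV. m j) - of_nat (m i)) * \<delta> - x $ i))"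

text \<open>
  \<^const>\<open>subgroup_generated\<close> only uses generators that lie in the carrier of the ambient group.
  The lemmas \<open>sigma_in_BijGroup\<close> and \<open>tau_in_BijGroup\<close> show that none is lost.
\<close>

lemma prod_cases8:
  obtains a b c d e f g h where "p = (a, b, c, d, e, f, g, h)"
  by (metis surj_pair)

lemma sigma_in_BijGroup: "sigma \<delta> i \<in> carrier (BijGroup (UNIV :: 'n::finite point set))"
proof -
  have "sigma \<delta> i (sigma \<delta> i p) = p" for p :: "'n point"
    by (cases p rule: prod_cases8) (simp add: sigma_def algebra_simps)
  then show ?thesis
    by (auto simp: BijGroup_def Bij_def intro!: o_bij[of "sigma \<delta> i"])
qed

lemma tau_in_BijGroup: "tau \<delta> m \<in> carrier (BijGroup (UNIV :: 'n::finite point set))"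
proof -
  have "tau \<delta> m (tau \<delta> m p) = p" for p :: "'n point"
    by (cases p rule: prod_cases8) (simp add: tau_def vec_eq_iff algebra_simps)
  then show ?thesis
    by (auto simp: BijGroup_def Bij_def intro!: o_bij[of "tau \<delta> m"])
qed

definition G_r :: "complex \<Rightarrow> ('n \<Rightarrow> nat) \<Rightarrow> ('n::finite point \<Rightarrow> 'n point) monoid" where
  "G_r \<delta> m = subgroup_generated (BijGroup UNIV) (sigma \<delta> ` {1, 2, 3, 4, 5} \<union> {tau \<delta> m})"

definition H_r :: "complex \<Rightarrow> ('n \<Rightarrow> nat) \<Rightarrow> ('n::finite point \<Rightarrow> 'n point) monoid" where
  "H_r \<delta> m = subgroup_generated (G_r \<delta> m) (sigma \<delta> ` {1, 2, 4, 5})"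

text \<open>Only the indices \<open>0, ..., 3\<close> are meaningful.\<close>

definition omega :: "complex \<Rightarrow> nat \<Rightarrow> 'n::finite point \<Rightarrow> 'n point" where
  "omega \<delta> i =
    (if i = 0 then id
     else if i = 1 then sigma \<delta> 3
     else if i = 2 then sigma \<delta> 3 \<circ> sigma \<delta> 4 \<circ> sigma \<delta> 2 \<circ> sigma \<delta> 3
     else if i = 3 then
       sigma \<delta> 3 \<circ> sigma \<delta> 4 \<circ> sigma \<delta> 5 \<circ> sigma \<delta> 2 \<circ> sigma \<delta> 1 \<circ>
       sigma \<delta> 3 \<circ> sigma \<delta> 4 \<circ> sigma \<delta> 2 \<circ> sigma \<delta> 3
     else id)"

definition double_coset :: "('a, 'b) monoid_scheme \<Rightarrow> 'a set \<Rightarrow> 'a \<Rightarrow> 'a set \<Rightarrow> 'a set" where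
  "double_coset G H g K = (H #>\<^bsub>G\<^esub> g) <#>\<^bsub>G\<^esub> K"

definition double_cosets :: "('a, 'b) monoid_scheme \<Rightarrow> 'a set \<Rightarrow> 'a set \<Rightarrow> 'a set set" where
  "double_cosets G H K = (\<lambda>g. double_coset G H g K) ` carrier G"

text \<open>
  The orbits, on \<open>H_r \ G_r / H_r\<close>, of left multiplication by the group generated by \<open>\<tau>\<close>.
  This action is well defined because \<open>\<tau>\<close> is central in \<open>G_r\<close>. As \<open>\<tau>\<close> does not lie in the
  group generated by the \<open>\<sigma>_i\<close>, each orbit consists of two double cosets.
\<close>

definition tau_orbit ::
  "complex \<Rightarrow> ('n \<Rightarrow> nat) \<Rightarrow> ('n::finite point \<Rightarrow> 'n point) set \<Rightarrow> ('n point \<Rightarrow> 'n point) set set"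
where
  "tau_orbit \<delta> m =
     Group_Action.orbit (subgroup_generated (G_r \<delta> m) {tau \<delta> m}) (\<lambda>t D. t <#\<^bsub>G_r \<delta> m\<^esub> D)"

definition tau_orbits ::
  "complex \<Rightarrow> ('n \<Rightarrow> nat) \<Rightarrow> ('n::finite point \<Rightarrow> 'n point) set set set"
where
  "tau_orbits \<delta> m =
     Group_Action.orbits (subgroup_generated (G_r \<delta> m) {tau \<delta> m})
       (double_cosets (G_r \<delta> m) (carrier (H_r \<delta> m)) (carrier (H_r \<delta> m)))
       (\<lambda>t D. t <#\<^bsub>G_r \<delta> m\<^esub> D)"

end

theory Submission
  imports Defs
begin

text \<open>
  The parameters \<open>(s, c0, c1, c2, d0, d1, d2)\<close> can be replaced by six quantities
  \<open>c2, c1, c0, s + \<delta> - d1 - d2, s + \<delta> - d0 - d2, s + \<delta> - d0 - d1\<close>, called \<open>y1, ..., y6\<close> below,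
  together with \<open>v = d0 + d1 + d2 - 2 * s\<close>. In these coordinates everything is transparent:
  \<open>\<sigma>_i\<close> exchanges \<open>y_i\<close> and \<open>y_(i+1)\<close> and fixes \<open>v\<close> and \<open>x\<close> (lemma \<open>sigma_eq_perm_act\<close>), while \<open>\<tau>\<close> adds
  one and the same number \<open>t\<close>, symmetric in the \<open>y\<close>, to all \<open>y_k\<close>, subtracts \<open>2 * t\<close> from \<open>v\<close>, and
  reflects \<open>x\<close> (lemma \<open>coord_tau\<close>). So the \<open>\<sigma>_i\<close> generate a faithful copy of
  the symmetric group of degree 6, \<open>\<tau>\<close> commutes with it, and \<open>\<tau>\<close> lies outside it because it moves
  \<open>v\<close>. Every element of the group is therefore \<open>perm_act \<delta> p \<circ> \<tau>^e\<close> for a unique permutation \<open>p\<close>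
  and a unique \<open>e \<in> {0, 1}\<close> (lemmas \<open>G_r_iso\<close>, \<open>carrier_G_r\<close>, \<open>group_elt_inj\<close>).
  
  The generators of \<open>H_r\<close> are the adjacent transpositions inside the blocks \<open>{1, 2, 3}\<close> and
  \<open>{4, 5, 6}\<close>, so \<open>H_r\<close> is the stabilizer of the block \<open>{1, 2, 3}\<close> (lemma \<open>carrier_H_r\<close>).
  Multiplying \<open>p\<close> by such elements on both sides rearranges points inside the blocks only; what
  survives is the number of points of \<open>{1, 2, 3}\<close> that \<open>p\<close> carries into the other block, and by
  \<open>crossing_eq_iff\<close> nothing else does. This number ranges over \<open>0, 1, 2, 3\<close>, and \<open>\<omega>_i\<close> is chosen
  so that its value is \<open>i\<close>. The double cosets are thus indexed by the pairs \<open>(i, e)\<close>, and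
  \<open>\<tau>\<close> toggles \<open>e\<close>, which gives four orbits.
\<close>

section \<open>Adjacent transpositions and generated subgroups\<close>

text \<open>
  An induction over arbitrary transpositions reduces to adjacent ones, because
  \<open>(i, j + 1)\<close> is the conjugate of \<open>(i, j)\<close> by \<open>(j, j + 1)\<close>.
\<close>

lemma permutes_adjacent_induct [consumes 1, case_names id swap]:
  fixes a b :: nat
  assumes p: "p permutes {a..b}"
    and id: "P id"
    and swap: "\<And>i q. a \<le> i \<Longrightarrow> i < b \<Longrightarrow> q permutes {a..b} \<Longrightarrow> P q
      \<Longrightarrow> P (transpose i (Suc i) \<circ> q)"
  shows "P p"
proof -
  have transp: "P (transpose i (i + k) \<circ> q)"
    if "a \<le> i" "i + k \<le> b" "q permutes {a..b}" "P q" for i k q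
    using that
  proof (induction k arbitrary: q)
    case 0
    then show ?case by simp
  next
    case (Suc k)
    show ?case
    proof (cases "k = 0")
      case True
      then show ?thesis using swap[of i q] Suc.prems by (simp add: comp_def)
    next
      case False
      let ?t = "transpose (i + k) (Suc (i + k))"
      have t: "?t permutes {a..b}" using Suc.prems by (intro permutes_swap_id) auto
      have u: "transpose i (i + k) permutes {a..b}"
        using Suc.prems by (intro permutes_swap_id) auto
      have Pt: "P (?t \<circ> r)" if "P r" "r permutes {a..b}" for r
        by (rule swap) (use that Suc.prems in simp_all)
      have "P (?t \<circ> q)" using Suc.prems by (intro Pt)
      moreover have "?t \<circ> q permutes {a..b}" by (rule permutes_compose[OF Suc.prems(3) t])
      moreover have "i + k \<le> b" using Suc.prems by simp
      ultimately have "P (transpose i (i + k) \<circ> (?t \<circ> q))"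
        using Suc.IH Suc.prems(1) by blast
      then have "P (?t \<circ> (transpose i (i + k) \<circ> (?t \<circ> q)))"
        using Suc.prems by (intro Pt permutes_compose[OF _ t] permutes_compose[OF _ u])
      also have "?t \<circ> (transpose i (i + k) \<circ> (?t \<circ> q)) = transpose i (i + Suc k) \<circ> q"
        using False by (auto simp: fun_eq_iff transpose_def)
      finally show ?thesis .
    qed
  qed
  from p finite_atLeastAtMost show ?thesis
  proof (induction rule: permutes_induct)
    case (swap i j q)
    show ?case
    proof (cases "i \<le> j")
      case True
      with swap transp[of i "j - i" q] show ?thesis by (metis atLeastAtMost_iff le_add_diff_inverse)
    next
      case False
      with swap transp[of j "i - j" q] show ?thesis
        by (metis atLeastAtMost_iff le_add_diff_inverse nat_le_linear transpose_commute)
    qed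
  qed (rule id)
qed

definition adjacent :: "nat \<Rightarrow> (nat \<Rightarrow> nat) set" where
  "adjacent n = (\<lambda>i. transpose i (Suc i)) ` {1..<n}"

lemma adjacent_subset: "adjacent n \<subseteq> carrier (sym_group n)"
  by (auto simp: adjacent_def sym_group_carrier intro!: permutes_swap_id)

lemma generate_adjacent_DirProd:
  "generate (sym_group k \<times>\<times> sym_group l) (adjacent k \<times> {id} \<union> {id} \<times> adjacent l)
     = carrier (sym_group k \<times>\<times> sym_group l)" (is "generate ?K ?S = _")
proof -
  interpret K: group ?K by (simp add: DirProd_group sym_group_is_group)
  have S: "?S \<subseteq> carrier ?K"
    using adjacent_subset[of k] adjacent_subset[of l] by (auto simp: sym_group_carrier)
  have *: "(p, id) \<in> generate ?K ?S" if "p permutes {1..k}" for p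
    using that
  proof (induction rule: permutes_adjacent_induct)
    case id
    then show ?case using generate.one[of ?K ?S] by (simp only: one_DirProd sym_group_one)
  next
    case (swap i q)
    then have "(transpose i (Suc i), id) \<in> generate ?K ?S"
      by (intro generate.incl) (auto simp: adjacent_def)
    from generate.eng[OF this swap(4)] show ?case by (simp only: mult_DirProd sym_group_mult id_comp)
  qed
  have **: "(id, p) \<in> generate ?K ?S" if "p permutes {1..l}" for p
    using that
  proof (induction rule: permutes_adjacent_induct)
    case id
    then show ?case using generate.one[of ?K ?S] by (simp only: one_DirProd sym_group_one)
  next
    case (swap i q)
    then have "(id, transpose i (Suc i)) \<in> generate ?K ?S"
      by (intro generate.incl) (auto simp: adjacent_def)
    from generate.eng[OF this swap(4)] show ?case by (simp only: mult_DirProd sym_group_mult id_comp)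
  qed
  have "(p, q) \<in> generate ?K ?S" if "p permutes {1..k}" "q permutes {1..l}" for p q
    using generate.eng[OF *[OF that(1)] **[OF that(2)]] by (simp add: sym_group_mult)
  moreover have "generate ?K ?S \<subseteq> carrier ?K" using K.generate_incl[OF S] .
  ultimately show ?thesis by (auto simp: sym_group_carrier)
qed

text \<open>
  A subgroup given by generators is identified with a known group by exhibiting an injective
  homomorphism that carries known generators to the given ones; both \<open>G_r\<close> and \<open>H_r\<close> are
  treated in this way.
\<close>

lemma iso_subgroup_generated_image:
  assumes "group K" "group L" and f: "f \<in> hom K L" and inj: "inj_on f (carrier K)"
    and S: "S \<subseteq> carrier K" "generate K S = carrier K"
  shows "f \<in> iso K (subgroup_generated L (f ` S))"
proof -
  interpret group_hom K L f
    using assms by (simp add: group_hom_def group_hom_axioms_def)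
  have "carrier (subgroup_generated L (f ` S)) = f ` carrier K"
    using generate_img[OF S(1)] S(2) hom_closed S(1) Int_absorb1[of "f ` S" "carrier L"]
    by (metis carrier_subgroup_generated image_subset_iff subsetD)
  then show ?thesis
    using f inj by (auto simp: iso_def hom_def bij_betw_def)
qed

section \<open>Double cosets of the stabilizer of a set\<close>

lemma permutes_block_match:
  assumes fin: "finite A" and X: "X \<subseteq> A" and Y: "Y \<subseteq> A" and card: "card X = card Y"
  obtains h where "h permutes A" "h ` X = Y"
proof -
  obtain f where f: "bij_betw f X Y"
    using fin X Y card by (meson finite_same_card_bij finite_subset)
  have "card (A - X) = card (A - Y)"
    using fin X Y card by (simp add: card_Diff_subset finite_subset)
  then obtain g where g: "bij_betw g (A - X) (A - Y)"
    using fin by (meson finite_Diff finite_same_card_bij)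
  let ?h = "\<lambda>x. if x \<in> X then f x else if x \<in> A then g x else x"
  have 1: "bij_betw ?h X Y" using f by (rule bij_betw_cong[THEN iffD1, rotated]) simp
  have 2: "bij_betw ?h (A - X) (A - Y)" using g by (rule bij_betw_cong[THEN iffD1, rotated]) simp
  have "bij_betw ?h (X \<union> (A - X)) (Y \<union> (A - Y))" by (rule bij_betw_combine[OF 1 2]) auto
  then have "?h permutes A"
    using X Y by (intro bij_imp_permutes) (auto simp: Un_absorb1)
  moreover have "?h ` X = Y" using 1 by (simp add: bij_betw_def)
  ultimately show ?thesis using that by blast
qed

definition set_stabilizer :: "'a set \<Rightarrow> 'a set \<Rightarrow> ('a \<Rightarrow> 'a) set" where
  "set_stabilizer U A = {p. p permutes U \<and> p ` A = A}"

text \<open>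
  The complete invariant of the double cosets of \<open>set_stabilizer U A\<close> in the symmetric group of a
  finite set \<open>U\<close> containing \<open>A\<close>.
\<close>

definition crossing :: "'a set \<Rightarrow> ('a \<Rightarrow> 'a) \<Rightarrow> nat" where
  "crossing A p = card (p ` A - A)"

text \<open>
  Left multiplication by an element of the stabilizer permutes \<open>- A\<close>, and right multiplication does
  not change the image of \<open>A\<close>. Conversely, if the crossing numbers agree, then \<open>p ` A\<close> and \<open>w ` A\<close>
  meet both \<open>A\<close> and \<open>U - A\<close> in equally many points, so some \<open>h\<close> in the stabilizer maps \<open>w ` A\<close>
  onto \<open>p ` A\<close>. Then \<open>k = inv w \<circ> inv h \<circ> p\<close> preserves \<open>A\<close> as well.
\<close>

lemma crossing_eq_iff:
  assumes fin: "finite U" and AU: "A \<subseteq> U" and p: "p permutes U" and w: "w permutes U"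
  shows "crossing A p = crossing A w \<longleftrightarrow>
    (\<exists>h\<in>set_stabilizer U A. \<exists>k\<in>set_stabilizer U A. p = h \<circ> w \<circ> k)" (is "?L \<longleftrightarrow> ?R")
proof
  assume ?R
  then obtain h k where hk: "h permutes U" "h ` A = A" "k ` A = A" "p = h \<circ> w \<circ> k"
    by (auto simp: set_stabilizer_def)
  have "p ` A - A = h ` (w ` A - A)"
    using hk permutes_inj[OF hk(1)] by (simp only: image_comp[symmetric] image_set_diff)
  then show ?L
    using permutes_inj[OF hk(1)]
    by (simp add: crossing_def card_image inj_on_subset)
next
  assume ?L
  have finA: "finite A" using fin AU finite_subset by blast
  have pU: "p ` A \<subseteq> U" "w ` A \<subseteq> U"
    using AU permutes_image[OF p] permutes_image[OF w] by blast+
  have c: "card (q ` A \<inter> A) + crossing A q = card A" if "q permutes U" for q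
    using card_Int_Diff[of "q ` A" A] finA permutes_inj[OF that]
    by (simp add: crossing_def card_image inj_on_subset)
  have "card (w ` A \<inter> A) = card (p ` A \<inter> A)"
    using c[OF p] c[OF w] \<open>?L\<close> by simp
  then obtain h1 where h1: "h1 permutes A" "h1 ` (w ` A \<inter> A) = p ` A \<inter> A"
    by (rule permutes_block_match[OF finA, rotated 2]) auto
  have "card (w ` A - A) = card (p ` A - A)" using \<open>?L\<close> by (simp add: crossing_def)
  then obtain h2 where h2: "h2 permutes (U - A)" "h2 ` (w ` A - A) = p ` A - A"
    by (rule permutes_block_match[of "U - A", rotated 3]) (use fin pU in auto)
  have fix1: "h1 ` X = X" if "X \<inter> A = {}" for X
  proof -
    have "h1 x = x" if "x \<in> X" for x
      using permutes_not_in[OF h1(1)] that \<open>X \<inter> A = {}\<close> by blast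
    then show ?thesis by simp
  qed
  have fix2: "h2 ` X = X" if "X \<subseteq> A" for X
  proof -
    have "h2 x = x" if "x \<in> X" for x
      using permutes_not_in[OF h2(1)] that \<open>X \<subseteq> A\<close> by blast
    then show ?thesis by simp
  qed
  \<comment> \<open>\<open>h1\<close> and \<open>h2\<close> act on the complementary sets \<open>A\<close> and \<open>U - A\<close>, so they do not interfere.\<close>
  define h where "h = h1 \<circ> h2"
  have hU: "h permutes U"
    unfolding h_def using h1(1) h2(1) AU
    by (meson Diff_subset permutes_compose permutes_subset)
  have hA: "h ` A = A"
    using fix2[of A] permutes_image[OF h1(1)] by (simp only: h_def image_comp[symmetric] order.refl)
  have "h ` (w ` A \<inter> A) = p ` A \<inter> A"
    using fix2[of "w ` A \<inter> A"] h1(2) by (metis h_def image_comp inf_le2)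
  moreover have "h ` (w ` A - A) = p ` A - A"
    using fix1[of "p ` A - A"] h2(2) by (metis h_def image_comp Diff_disjoint Int_commute)
  ultimately have hw: "h ` (w ` A) = p ` A" by (metis Int_Diff_Un image_Un)
  define k where "k = inv' w \<circ> (inv' h \<circ> p)"
  have k: "k permutes U"
    unfolding k_def using hU p w by (intro permutes_compose permutes_inv)
  have "k ` A = inv' w ` (inv' h ` (h ` (w ` A)))"
    by (simp only: k_def image_comp[symmetric] hw)
  also have "\<dots> = A"
    using permutes_inj[OF hU] permutes_inj[OF w] by (simp only: image_inv_f_f)
  finally have "k ` A = A" .
  moreover have "p = h \<circ> w \<circ> k"
    using permutes_inverses(1)[OF hU] permutes_inverses(1)[OF w]
    by (simp add: k_def fun_eq_iff)
  ultimately show ?R using k hU hA by (auto simp: set_stabilizer_def)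
qed

section \<open>Coordinates in which the generators act by permutations\<close>

text \<open>
  The six quantities that the \<open>\<sigma>_i\<close> permute. They can be read off the differences
  \<open>y_(i+1) - y_i\<close>: the map \<open>\<sigma>_i\<close> moves every point by a multiple of a fixed vector, the factor being
  \<open>c1 - c2, c0 - c1, s + \<delta> - c0 - d1 - d2, d1 - d0, d2 - d1\<close> up to sign. Only the values at
  \<open>1, ..., 6\<close> are meaningful.
\<close>

definition ycoord :: "complex \<Rightarrow> 'n::finite point \<Rightarrow> nat \<Rightarrow> complex" where
  "ycoord \<delta> = (\<lambda>(s, c0, c1, c2, d0, d1, d2, x) k.
     if k = 1 then c2 else if k = 2 then c1 else if k = 3 then c0
     else if k = 4 then s + \<delta> - d1 - d2 else if k = 5 then s + \<delta> - d0 - d2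
     else s + \<delta> - d0 - d1)"

text \<open>
  It completes the \<open>y\<close> to coordinates of the parameters and is invariant under all \<open>\<sigma>_i\<close>: \<open>\<sigma>_3\<close> adds twice as much
  to \<open>d0 + d1 + d2\<close> as to \<open>s\<close>.
\<close>

definition vcoord :: "'n::finite point \<Rightarrow> complex" where
  "vcoord = (\<lambda>(s, c0, c1, c2, d0, d1, d2, x). d0 + d1 + d2 - 2 * s)"

definition xcoord :: "'n::finite point \<Rightarrow> complex ^ 'n" where
  "xcoord = (\<lambda>(s, c0, c1, c2, d0, d1, d2, x). x)"

text \<open>
  The inverse of the change of coordinates. The sum of \<open>y4, y5, y6\<close> is
  \<open>3 * s + 3 * \<delta> - 2 * (d0 + d1 + d2)\<close>, in which \<open>d0 + d1 + d2 = 2 * s + v\<close>; this determines \<open>s\<close>.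
\<close>

definition point_of ::
  "complex \<Rightarrow> (nat \<Rightarrow> complex) \<Rightarrow> complex \<Rightarrow> complex ^ 'n \<Rightarrow> 'n::finite point" where
  "point_of \<delta> Y v x =
     (let s = 3 * \<delta> - 2 * v - Y 4 - Y 5 - Y 6; D = 2 * s + v; e = D - s - \<delta>
      in (s, Y 3, Y 2, Y 1, e + Y 4, e + Y 5, e + Y 6, x))"

lemma atLeastAtMost_1_6: "{1..6::nat} = {1, 2, 3, 4, 5, 6}"
  by (simp add: numeral_eq_Suc atLeastAtMostSuc_conv insert_commute)

lemma ball_1_6: "(\<forall>k\<in>{1..6::nat}. Q k) \<longleftrightarrow> Q 1 \<and> Q 2 \<and> Q 3 \<and> Q 4 \<and> Q 5 \<and> Q 6"
  unfolding atLeastAtMost_1_6 by simp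

lemma point_eqI:
  fixes P Q :: "'n::finite point"
  assumes "\<And>k. k \<in> {1..6} \<Longrightarrow> ycoord \<delta> P k = ycoord \<delta> Q k"
    and "vcoord P = vcoord Q" and "xcoord P = xcoord Q"
  shows "P = Q"
proof -
  have *: "point_of \<delta> (ycoord \<delta> R) (vcoord R) (xcoord R) = R" for R :: "'n point"
    by (cases R rule: prod_cases8)
      (simp add: point_of_def ycoord_def vcoord_def xcoord_def Let_def)
  have "\<forall>k\<in>{1..6}. ycoord \<delta> P k = ycoord \<delta> Q k" using assms(1) by blast
  then have "point_of \<delta> (ycoord \<delta> P) (vcoord P) (xcoord P)
      = point_of \<delta> (ycoord \<delta> Q) (vcoord Q) (xcoord Q)"
    unfolding ball_1_6 using assms(2,3) by (simp add: point_of_def)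
  then show ?thesis by (simp only: *)
qed

lemma coord_point_of [simp]:
  "k \<in> {1..6} \<Longrightarrow> ycoord \<delta> (point_of \<delta> Y v x) k = Y k"
  "vcoord (point_of \<delta> Y v x) = v"
  "xcoord (point_of \<delta> Y v x) = x"
proof -
  have "\<forall>k\<in>{1..6}. ycoord \<delta> (point_of \<delta> Y v x) k = Y k"
    unfolding ball_1_6 by (simp add: ycoord_def point_of_def Let_def)
  then show "k \<in> {1..6} \<Longrightarrow> ycoord \<delta> (point_of \<delta> Y v x) k = Y k" by blast
qed (simp_all add: vcoord_def xcoord_def point_of_def Let_def)

text \<open>
  The inverse of \<open>p\<close> makes this a left action, so that composition is respected in the
  same order.
\<close>

definition perm_act :: "complex \<Rightarrow> (nat \<Rightarrow> nat) \<Rightarrow> 'n::finite point \<Rightarrow> 'n point" where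
  "perm_act \<delta> p P = point_of \<delta> (ycoord \<delta> P \<circ> inv' p) (vcoord P) (xcoord P)"

lemma coord_perm_act [simp]:
  "k \<in> {1..6} \<Longrightarrow> ycoord \<delta> (perm_act \<delta> p P) k = ycoord \<delta> P (inv' p k)"
  "vcoord (perm_act \<delta> p P) = vcoord P"
  "xcoord (perm_act \<delta> p P) = xcoord P"
  by (simp_all add: perm_act_def del: atLeastAtMost_iff)

lemma permutes_inv_mem: "p permutes S \<Longrightarrow> k \<in> S \<Longrightarrow> inv' p k \<in> S"
  by (simp add: permutes_in_image[OF permutes_inv])

lemma perm_act_id: "perm_act \<delta> id = id"
proof (rule ext)
  fix P :: "'n::finite point"
  have 1: "ycoord \<delta> (perm_act \<delta> id P) k = ycoord \<delta> P k" if "k \<in> {1..6}" for k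
    using that by (simp only: coord_perm_act inv_id id_apply)
  have "perm_act \<delta> id P = P"
    using 1 coord_perm_act(2,3) by (rule point_eqI)
  then show "perm_act \<delta> id P = id P" by simp
qed

lemma perm_act_comp:
  assumes p: "p permutes {1..6}" and q: "q permutes {1..6}"
  shows "perm_act \<delta> (p \<circ> q) = perm_act \<delta> p \<circ> perm_act \<delta> q"
proof (rule ext)
  fix P :: "'n::finite point"
  have "inv' (p \<circ> q) k = inv' q (inv' p k)" for k
    using permutes_bij[OF p] permutes_bij[OF q] by (simp add: o_inv_distrib)
  then show "perm_act \<delta> (p \<circ> q) P = (perm_act \<delta> p \<circ> perm_act \<delta> q) P"
    using permutes_inv_mem[OF p]
    by (intro point_eqI[where \<delta> = \<delta>]) (simp_all del: atLeastAtMost_iff)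
qed

text \<open>
  The action is faithful since a point with pairwise distinct \<open>y\<close> coordinates reveals the permutation.
\<close>

lemma perm_act_inj:
  assumes p: "p permutes {1..6}" and q: "q permutes {1..6}"
    and eq: "perm_act \<delta> p = (perm_act \<delta> q :: 'n::finite point \<Rightarrow> _)"
  shows "p = q"
proof -
  let ?P = "point_of \<delta> of_nat 0 0 :: 'n point"
  have "inv' p k = inv' q k" if k: "k \<in> {1..6}" for k
  proof -
    have "ycoord \<delta> (perm_act \<delta> p ?P) k = ycoord \<delta> (perm_act \<delta> q ?P) k" by (simp add: eq)
    then show ?thesis
      using k permutes_inv_mem[OF p k] permutes_inv_mem[OF q k] by (simp del: atLeastAtMost_iff)
  qed
  moreover have "inv' p k = inv' q k" if "k \<notin> {1..6}" for k
    using permutes_not_in[OF permutes_inv[OF p] that] permutes_not_in[OF permutes_inv[OF q] that]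
    by simp
  ultimately have "inv' p = inv' q" by blast
  then show ?thesis by (metis p q permutes_inv_inv)
qed

lemma sigma_eq_perm_act:
  assumes "i \<in> {1..5}"
  shows "sigma \<delta> i = perm_act \<delta> (transpose i (Suc i))"
proof (rule ext)
  fix P :: "'n::finite point"
  have i: "i = 1 \<or> i = 2 \<or> i = 3 \<or> i = 4 \<or> i = 5" using assms by auto
  have *: "\<forall>k\<in>{1..6}. ycoord \<delta> (sigma \<delta> i P) k = ycoord \<delta> P (transpose i (Suc i) k)"
    unfolding ball_1_6 using i
    by (cases P rule: prod_cases8) (elim disjE; simp add: sigma_def ycoord_def transpose_def)
  have v: "vcoord (sigma \<delta> i P) = vcoord P" and x: "xcoord (sigma \<delta> i P) = xcoord P"
    by (cases P rule: prod_cases8; simp add: sigma_def vcoord_def xcoord_def)+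
  show "sigma \<delta> i P = perm_act \<delta> (transpose i (Suc i)) P"
  proof (rule point_eqI)
    fix k :: nat assume "k \<in> {1..6}"
    with * show "ycoord \<delta> (sigma \<delta> i P) k = ycoord \<delta> (perm_act \<delta> (transpose i (Suc i)) P) k"
      by (simp only: coord_perm_act inv_transpose_eq)
  qed (simp_all add: v x)
qed

text \<open>
  This is \<open>s + \<delta> - c0 - c1 - c2\<close>, written so as to be visibly symmetric in the \<open>y\<close> coordinates; the
  symmetry is the reason why \<open>\<tau>\<close> is central.
\<close>

definition tau_shift :: "complex \<Rightarrow> 'n::finite point \<Rightarrow> complex" where
  "tau_shift \<delta> P = 4 * \<delta> - 2 * vcoord P - (\<Sum>k=1..6. ycoord \<delta> P k)"

lemma sum_1_6: "(\<Sum>k=1..6::nat. f k) = f 1 + f 2 + f 3 + f 4 + f 5 + (f 6 :: complex)"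
  unfolding atLeastAtMost_1_6 by (simp add: add.assoc)

lemma coord_tau:
  "k \<in> {1..6} \<Longrightarrow> ycoord \<delta> (tau \<delta> m P) k = ycoord \<delta> P k + tau_shift \<delta> P"
  "vcoord (tau \<delta> m P) = vcoord P - 2 * tau_shift \<delta> P"
  "xcoord (tau \<delta> m P) = (\<chi> i. (of_nat (\<Sum>j\<in>UNIV. m j) - of_nat (m i)) * \<delta> - xcoord P $ i)"
proof -
  have "\<forall>k\<in>{1..6}. ycoord \<delta> (tau \<delta> m P) k = ycoord \<delta> P k + tau_shift \<delta> P"
    unfolding ball_1_6 tau_shift_def sum_1_6
    by (cases P rule: prod_cases8) (simp add: ycoord_def tau_def vcoord_def algebra_simps)
  then show "k \<in> {1..6} \<Longrightarrow> ycoord \<delta> (tau \<delta> m P) k = ycoord \<delta> P k + tau_shift \<delta> P" by blast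
  show "vcoord (tau \<delta> m P) = vcoord P - 2 * tau_shift \<delta> P"
    unfolding tau_shift_def sum_1_6
    by (cases P rule: prod_cases8) (simp add: ycoord_def tau_def vcoord_def algebra_simps)
  show "xcoord (tau \<delta> m P) = (\<chi> i. (of_nat (\<Sum>j\<in>UNIV. m j) - of_nat (m i)) * \<delta> - xcoord P $ i)"
    by (cases P rule: prod_cases8) (simp add: xcoord_def tau_def)
qed

lemma tau_shift_perm_act:
  assumes p: "p permutes {1..6}"
  shows "tau_shift \<delta> (perm_act \<delta> p P) = tau_shift \<delta> P"
proof -
  have "(\<Sum>k=1..6. ycoord \<delta> (perm_act \<delta> p P) k) = (\<Sum>k=1..6. ycoord \<delta> P (inv' p k))"
    by (rule sum.cong) (simp_all del: atLeastAtMost_iff)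
  also have "\<dots> = (\<Sum>k=1..6. ycoord \<delta> P k)"
    using sum.permute[OF permutes_inv[OF p], of "ycoord \<delta> P"] by (simp add: o_def)
  finally show ?thesis by (simp add: tau_shift_def)
qed

lemma tau_perm_act:
  fixes m :: "'n::finite \<Rightarrow> nat"
  assumes p: "p permutes {1..6}"
  shows "tau \<delta> m \<circ> perm_act \<delta> p = perm_act \<delta> p \<circ> tau \<delta> m"
proof (rule ext)
  fix P :: "'n point"
  show "(tau \<delta> m \<circ> perm_act \<delta> p) P = (perm_act \<delta> p \<circ> tau \<delta> m) P"
    using permutes_inv_mem[OF p]
    by (intro point_eqI[where \<delta> = \<delta>])
      (simp_all del: atLeastAtMost_iff add: coord_tau tau_shift_perm_act[OF p])
qed

lemma tau_tau:
  fixes m :: "'n::finite \<Rightarrow> nat"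
  shows "tau \<delta> m \<circ> tau \<delta> m = id"
proof (rule ext)
  fix P :: "'n point"
  show "(tau \<delta> m \<circ> tau \<delta> m) P = id P"
    by (cases P rule: prod_cases8) (simp add: tau_def vec_eq_iff algebra_simps)
qed

text \<open>
  The coordinate \<open>v\<close> tells \<open>e\<close>, since permutations preserve it and \<open>\<tau>\<close> changes it wherever the shift
  is nonzero.
\<close>

lemma perm_act_tau_inj:
  fixes m :: "'n::finite \<Rightarrow> nat"
  assumes p: "p permutes {1..6}" and q: "q permutes {1..6}"
    and e: "e \<in> {0..1::nat}" and f: "f \<in> {0..1}"
    and eq: "perm_act \<delta> p \<circ> tau \<delta> m ^^ e = perm_act \<delta> q \<circ> tau \<delta> m ^^ f"
  shows "p = q \<and> e = f"
proof -
  \<comment> \<open>Any value of \<open>v\<close> other than \<open>2 * \<delta>\<close> makes the shift nonzero at \<open>y = 0\<close>.\<close>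
  let ?P = "point_of \<delta> (\<lambda>_. 0) (2 * \<delta> + 1) 0 :: 'n point"
  have T: "tau_shift \<delta> ?P = - 2"
    unfolding tau_shift_def sum_1_6 by (simp add: algebra_simps)
  have v: "vcoord (perm_act \<delta> r (tau \<delta> m ?P)) = vcoord ?P + 4" for r
    by (simp only: coord_perm_act coord_tau T) simp
  have eq': "perm_act \<delta> p ((tau \<delta> m ^^ e) ?P) = perm_act \<delta> q ((tau \<delta> m ^^ f) ?P)"
    using fun_cong[OF eq, of ?P] by (simp only: comp_apply)
  have e01: "e = 0 \<or> e = 1" "f = 0 \<or> f = 1" using e f by auto
  have ef: "e = f"
    using e01 arg_cong[OF eq', of vcoord] v[of p] v[of q] by (elim disjE) simp_all
  have tt: "tau \<delta> m ^^ e \<circ> tau \<delta> m ^^ e = id"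
    using e01(1) by (elim disjE) (simp_all only: funpow.simps One_nat_def comp_id tau_tau id_comp)
  have "perm_act \<delta> p \<circ> tau \<delta> m ^^ e \<circ> tau \<delta> m ^^ e = perm_act \<delta> q \<circ> tau \<delta> m ^^ e \<circ> tau \<delta> m ^^ e"
    using eq unfolding ef by (rule arg_cong)
  then have "perm_act \<delta> p = (perm_act \<delta> q :: 'n point \<Rightarrow> _)"
    by (simp only: comp_assoc tt comp_id)
  with p q ef show ?thesis using perm_act_inj by metis
qed

section \<open>The structure of the full group\<close>

lemma BijGroup_UNIV:
  "f \<in> carrier (BijGroup UNIV) \<longleftrightarrow> bij f"
  "bij f \<Longrightarrow> bij g \<Longrightarrow> f \<otimes>\<^bsub>BijGroup UNIV\<^esub> g = f \<circ> g"
  "\<one>\<^bsub>BijGroup UNIV\<^esub> = id"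
  by (auto simp: BijGroup_def Bij_def compose_def fun_eq_iff)

lemma bij_perm_act:
  assumes p: "p permutes {1..6}"
  shows "bij (perm_act \<delta> p)"
proof (rule o_bij)
  note i = permutes_inv[OF p]
  show "perm_act \<delta> (inv' p) \<circ> perm_act \<delta> p = id"
    using perm_act_comp[OF i p, of \<delta>] permutes_inv_o(2)[OF p] perm_act_id by metis
  show "perm_act \<delta> p \<circ> perm_act \<delta> (inv' p) = id"
    using perm_act_comp[OF p i, of \<delta>] permutes_inv_o(1)[OF p] perm_act_id by metis
qed

lemma bij_tau: "bij (tau \<delta> m)"
  using tau_tau tau_tau by (rule o_bij)

definition group_elt ::
  "complex \<Rightarrow> ('n \<Rightarrow> nat) \<Rightarrow> (nat \<Rightarrow> nat) \<Rightarrow> nat \<Rightarrow> 'n::finite point \<Rightarrow> 'n point" where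
  "group_elt \<delta> m p e = perm_act \<delta> p \<circ> (tau \<delta> m ^^ e)"

lemma bij_group_elt: "p permutes {1..6} \<Longrightarrow> bij (group_elt \<delta> m p e)"
  unfolding group_elt_def by (intro bij_comp bij_perm_act bij_fn bij_tau)

lemma group_elt_comp:
  assumes p: "p permutes {1..6}" and q: "q permutes {1..6}"
    and e: "e \<in> {0..1}" and f: "f \<in> {0..1}"
  shows "group_elt \<delta> m p e \<circ> group_elt \<delta> m q f = group_elt \<delta> m (p \<circ> q) ((e + f) mod 2)"
proof -
  have e01: "e = 0 \<or> e = 1" "f = 0 \<or> f = 1" using e f by auto
  have 1: "tau \<delta> m ^^ e \<circ> perm_act \<delta> q = perm_act \<delta> q \<circ> tau \<delta> m ^^ e"
    using e01(1) tau_perm_act[OF q, of \<delta> m]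
    by (elim disjE) (simp_all only: funpow.simps One_nat_def comp_id id_comp)
  have 2: "tau \<delta> m ^^ e \<circ> tau \<delta> m ^^ f = tau \<delta> m ^^ ((e + f) mod 2)"
  proof (cases "e = 1 \<and> f = 1")
    case True
    then have "(e + f) mod 2 = 0" by simp
    with True show ?thesis by (simp only: funpow.simps One_nat_def comp_id tau_tau)
  next
    case False
    with e01 have "(e + f) mod 2 = e + f" by auto
    then show ?thesis by (simp only: funpow_add)
  qed
  have "group_elt \<delta> m p e \<circ> group_elt \<delta> m q f
      = perm_act \<delta> p \<circ> (tau \<delta> m ^^ e \<circ> perm_act \<delta> q) \<circ> tau \<delta> m ^^ f"
    by (simp only: group_elt_def comp_assoc)
  also have "\<dots> = perm_act \<delta> p \<circ> perm_act \<delta> q \<circ> (tau \<delta> m ^^ e \<circ> tau \<delta> m ^^ f)"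
    by (simp only: 1 comp_assoc)
  also have "\<dots> = group_elt \<delta> m (p \<circ> q) ((e + f) mod 2)"
    by (simp only: 2 group_elt_def perm_act_comp[OF p q])
  finally show ?thesis .
qed

lemma group_elt_inj:
  assumes "p permutes {1..6}" "q permutes {1..6}" "e \<in> {0..1}" "f \<in> {0..1}"
    and "group_elt \<delta> m p e = group_elt \<delta> m q f"
  shows "p = q" "e = f"
  using perm_act_tau_inj[OF assms(1-4)] assms(5) unfolding group_elt_def by blast+

text \<open>
  The isomorphism of the symmetric group of degree 2 with the exponents of \<open>\<tau>\<close> modulo 2.
\<close>

definition swap_exp :: "(nat \<Rightarrow> nat) \<Rightarrow> nat" where
  "swap_exp q = (if q = id then 0 else 1)"

lemma sym_group_2_cases:
  assumes "q permutes {1..2::nat}"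
  shows "q = id \<or> q = transpose 1 2"
proof -
  have "{1..2::nat} = {1, 2}" by auto
  with assms show ?thesis using permutes_doubleton_iff[of q 1 "2::nat"] by simp
qed

lemma transpose_1_2_neq_id: "transpose 1 (2::nat) \<noteq> id"
proof
  assume "transpose 1 (2::nat) = id"
  then have "transpose 1 (2::nat) 1 = id 1" by (rule fun_cong)
  then show False by simp
qed

lemma swap_exp_comp:
  assumes "q permutes {1..2}" "r permutes {1..2}"
  shows "swap_exp (q \<circ> r) = (swap_exp q + swap_exp r) mod 2"
  using sym_group_2_cases[OF assms(1)] sym_group_2_cases[OF assms(2)] transpose_1_2_neq_id
  by (elim disjE) (simp_all add: swap_exp_def)

lemma swap_exp_inj:
  assumes "q permutes {1..2}" "r permutes {1..2}" "swap_exp q = swap_exp r"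
  shows "q = r"
  using sym_group_2_cases[OF assms(1)] sym_group_2_cases[OF assms(2)] assms(3)
  unfolding swap_exp_def by (metis zero_neq_one)

lemma swap_exp_range: "swap_exp q \<in> {0..1}"
  by (simp add: swap_exp_def)

abbreviation group_elt_pair where
  "group_elt_pair \<delta> m \<equiv> \<lambda>(p, q). group_elt \<delta> m p (swap_exp q)"

lemma adjacent_6: "adjacent 6 = (\<lambda>i. transpose i (Suc i)) ` {1, 2, 3, 4, 5}"
  and adjacent_2: "adjacent 2 = {transpose 1 2}"
  and adjacent_3: "adjacent 3 = {transpose 1 2, transpose 2 3}"
proof -
  have "{1..<6::nat} = {1, 2, 3, 4, 5}" "{1..<2::nat} = {1}" "{1..<3::nat} = {1, 2}" by auto
  then show "adjacent 6 = (\<lambda>i. transpose i (Suc i)) ` {1, 2, 3, 4, 5}"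
    "adjacent 2 = {transpose 1 2}" "adjacent 3 = {transpose 1 2, transpose 2 3}"
    by (simp_all add: adjacent_def numeral_eq_Suc)
qed

text \<open>
  Injectivity and the homomorphism property hold because \<open>\<tau>\<close> is a central involution outside the
  image of the permutations; the adjacent transpositions go to the \<open>\<sigma>_i\<close> and the nontrivial element
  of the second factor goes to \<open>\<tau>\<close>.
\<close>

lemma G_r_iso:
  fixes m :: "'n::finite \<Rightarrow> nat"
  shows "group_elt_pair \<delta> m \<in> iso (sym_group 6 \<times>\<times> sym_group 2) (G_r \<delta> m)"
proof -
  let ?K = "sym_group 6 \<times>\<times> sym_group 2"
  let ?S = "adjacent 6 \<times> {id} \<union> {id} \<times> adjacent 2"
  let ?B = "BijGroup (UNIV :: 'n point set)"
  have gens: "group_elt_pair \<delta> m ` ?S = sigma \<delta> ` {1, 2, 3, 4, 5} \<union> {tau \<delta> m}"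
  proof -
    have "group_elt_pair \<delta> m ` ?S = (\<lambda>p. group_elt \<delta> m p 0) ` adjacent 6 \<union> {group_elt \<delta> m id 1}"
      using transpose_1_2_neq_id
      unfolding image_Un adjacent_2 by (force simp: swap_exp_def image_iff)
    also have "(\<lambda>p. group_elt \<delta> m p 0) ` adjacent 6 = sigma \<delta> ` {1, 2, 3, 4, 5}"
      unfolding adjacent_6 image_image group_elt_def funpow.simps comp_id
      by (intro image_cong refl) (auto simp: sigma_eq_perm_act)
    also have "group_elt \<delta> m id 1 = tau \<delta> m"
      by (simp only: group_elt_def perm_act_id funpow.simps One_nat_def id_comp comp_id)
    finally show ?thesis .
  qed
  have "group_elt_pair \<delta> m \<in> iso ?K (subgroup_generated ?B (group_elt_pair \<delta> m ` ?S))"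
  proof (rule iso_subgroup_generated_image)
    show "group_elt_pair \<delta> m \<in> hom ?K ?B"
    proof (rule homI; clarsimp simp only: carrier_DirProd mem_Sigma_iff mult_DirProd
        sym_group_carrier sym_group_mult BijGroup_UNIV bij_group_elt prod.case)
      fix p q p' q' :: "nat \<Rightarrow> nat"
      assume *: "p permutes {1..6}" "q permutes {1..2}" "p' permutes {1..6}" "q' permutes {1..2}"
      note swap_exp_comp[OF *(2,4)] group_elt_comp[OF *(1,3) swap_exp_range swap_exp_range]
      then show "group_elt \<delta> m (p \<circ> p') (swap_exp (q \<circ> q')) =
          group_elt \<delta> m p (swap_exp q) \<circ> group_elt \<delta> m p' (swap_exp q')"
        by metis
    qed
    show "inj_on (group_elt_pair \<delta> m) (carrier ?K)"
    proof (rule inj_onI; clarsimp simp only: carrier_DirProd mem_Sigma_iff sym_group_carrier prod.case prod.inject)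
      fix p q p' q' :: "nat \<Rightarrow> nat"
      assume *: "p permutes {1..6}" "q permutes {1..2}" "p' permutes {1..6}" "q' permutes {1..2}"
        "group_elt \<delta> m p (swap_exp q) = group_elt \<delta> m p' (swap_exp q')"
      then show "p = p' \<and> q = q'"
        using group_elt_inj[OF *(1,3) swap_exp_range swap_exp_range *(5)] swap_exp_inj[OF *(2,4)]
        by metis
    qed
    show "?S \<subseteq> carrier ?K"
      using adjacent_subset[of 6] adjacent_subset[of 2] by (auto simp: sym_group_carrier)
  qed (simp_all add: DirProd_group sym_group_is_group group_BijGroup generate_adjacent_DirProd)
  then show ?thesis by (simp only: gens G_r_def)
qed


lemma carrier_G_r:
  "carrier (G_r \<delta> m) = {group_elt \<delta> m p e | p e. p permutes {1..6} \<and> e \<in> {0..1}}"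
proof -
  have "carrier (G_r \<delta> m) = group_elt_pair \<delta> m ` carrier (sym_group 6 \<times>\<times> sym_group 2)"
    using G_r_iso[of \<delta> m] by (simp add: iso_def bij_betw_def)
  also have "\<dots> = {group_elt \<delta> m p e | p e. p permutes {1..6} \<and> e \<in> {0..1}}"
  proof (intro equalityI subsetI)
    fix g assume "g \<in> {group_elt \<delta> m p e | p e. p permutes {1..6} \<and> e \<in> {0..1}}"
    then obtain p e where g: "g = group_elt \<delta> m p e" "p permutes {1..6}" "e \<in> {0..1}" by blast
    let ?q = "if e = 0 then id else transpose 1 (2::nat)"
    have "swap_exp ?q = e" using g(3) transpose_1_2_neq_id by (auto simp: swap_exp_def)
    moreover have "?q permutes {1..2}" by (auto intro: permutes_swap_id)
    ultimately show "g \<in> group_elt_pair \<delta> m ` carrier (sym_group 6 \<times>\<times> sym_group 2)"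
      using g by (intro image_eqI[of _ _ "(p, ?q)"]) (simp_all add: sym_group_carrier)
  next
    fix g assume "g \<in> group_elt_pair \<delta> m ` carrier (sym_group 6 \<times>\<times> sym_group 2)"
    then obtain p q where "g = group_elt \<delta> m p (swap_exp q)" "p permutes {1..6}"
      by (auto simp: sym_group_carrier)
    then show "g \<in> {group_elt \<delta> m p e | p e. p permutes {1..6} \<and> e \<in> {0..1}}"
      using swap_exp_range by blast
  qed
  finally show ?thesis .
qed

lemma perm_act_eq_group_elt: "perm_act \<delta> p = group_elt \<delta> m p 0"
  by (simp only: group_elt_def funpow.simps comp_id)

lemma group_elt_in_G_r: "p permutes {1..6} \<Longrightarrow> e \<in> {0..1} \<Longrightarrow> group_elt \<delta> m p e \<in> carrier (G_r \<delta> m)"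
  unfolding carrier_G_r by blast

lemma group_G_r: "group (G_r \<delta> m)"
  unfolding G_r_def by (rule group.group_subgroup_generated[OF group_BijGroup])

lemma mult_G_r: "bij f \<Longrightarrow> bij g \<Longrightarrow> f \<otimes>\<^bsub>G_r \<delta> m\<^esub> g = f \<circ> g"
  by (simp only: G_r_def mult_subgroup_generated BijGroup_UNIV)

section \<open>The subgroup of permutations within the blocks\<close>

text \<open>
  The first factor accounts for the permutations of \<open>c0, c1, c2\<close>, which are themselves the
  coordinates \<open>y3, y2, y1\<close>; the second one accounts for those of \<open>d0, d1, d2\<close>, which permute
  \<open>y4, y5, y6\<close> in the same way.
\<close>

definition block_perm :: "(nat \<Rightarrow> nat) \<times> (nat \<Rightarrow> nat) \<Rightarrow> nat \<Rightarrow> nat" where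
  "block_perm = (\<lambda>(p, q). p \<circ> map_permutation {1..3} (\<lambda>k. k + 3) q)"

lemma shift_bij: "bij_betw (\<lambda>k::nat. k + 3) {1..3} {4..6}"
  by (rule bij_betw_byWitness[where f' = "\<lambda>k. k - 3"]) auto

lemma shift_inj: "inj_on (\<lambda>k::nat. k + 3) {1..3}"
  using shift_bij by (rule bij_betw_imp_inj_on)

lemma disjoint_permutes_commute:
  assumes p: "p permutes A" and q: "q permutes B" and AB: "A \<inter> B = {}"
  shows "p \<circ> q = q \<circ> p"
proof (rule ext)
  fix x
  show "(p \<circ> q) x = (q \<circ> p) x"
    using AB permutes_not_in[OF p] permutes_not_in[OF q] permutes_in_image[OF p]
      permutes_in_image[OF q] by (metis comp_apply disjoint_iff)
qed

lemma block_perm_permutes: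
  assumes p: "p permutes {1..3}" and q: "q permutes {1..3}"
  shows "block_perm (p, q) permutes {1..6}" "x \<in> {1..3} \<Longrightarrow> block_perm (p, q) x = p x"
    "x \<in> {1..3} \<Longrightarrow> block_perm (p, q) (x + 3) = q x + 3" "block_perm (p, q) ` {1..3} = {1..3}"
proof -
  let ?q = "map_permutation {1..3} (\<lambda>k. k + 3) q"
  have q': "?q permutes {4..6}" by (rule map_permutation_permutes[OF shift_bij q])
  show "block_perm (p, q) permutes {1..6}"
    unfolding block_perm_def prod.case
    by (rule permutes_compose[OF permutes_subset[OF q'] permutes_subset[OF p]]) auto
  show *: "block_perm (p, q) x = p x" if "x \<in> {1..3}" for x
    using permutes_not_in[OF q', of x] that by (simp add: block_perm_def)
  show "block_perm (p, q) (x + 3) = q x + 3" if "x \<in> {1..3}"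
  proof -
    have "q x \<in> {1..3}" using that by (simp only: permutes_in_image[OF q])
    then have "p (q x + 3) = q x + 3" by (intro permutes_not_in[OF p]) auto
    then show ?thesis
      using map_permutation_apply[OF shift_inj that, of q]
      by (simp only: block_perm_def prod.case comp_apply)
  qed
  have "block_perm (p, q) ` {1..3} = p ` {1..3}" using * by (rule image_cong[OF refl])
  then show "block_perm (p, q) ` {1..3} = {1..3}" by (simp only: permutes_image[OF p])
qed

lemma block_perm_comp:
  assumes p: "p permutes {1..3}" and q: "q permutes {1..3}"
    and p': "p' permutes {1..3}" and q': "q' permutes {1..3}"
  shows "block_perm (p \<circ> p', q \<circ> q') = block_perm (p, q) \<circ> block_perm (p', q')"
proof -
  let ?M = "map_permutation {1..3} (\<lambda>k. k + 3) :: (nat \<Rightarrow> nat) \<Rightarrow> _"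
  have "?M q permutes {4..6}" by (rule map_permutation_permutes[OF shift_bij q])
  then have c: "p' \<circ> ?M q = ?M q \<circ> p'" by (rule disjoint_permutes_commute[OF p']) auto
  have "block_perm (p \<circ> p', q \<circ> q') = p \<circ> (p' \<circ> ?M q) \<circ> ?M q'"
    by (simp only: block_perm_def prod.case map_permutation_compose'[OF shift_inj q'] comp_assoc)
  also have "\<dots> = block_perm (p, q) \<circ> block_perm (p', q')"
    by (simp only: c block_perm_def prod.case comp_assoc)
  finally show ?thesis .
qed

lemma block_perm_inj: "inj_on block_perm (carrier (sym_group 3 \<times>\<times> sym_group 3))"
proof (rule inj_onI; clarsimp simp only: carrier_DirProd mem_Sigma_iff sym_group_carrier prod.case prod.inject)
  fix p q p' q' :: "nat \<Rightarrow> nat"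
  assume *: "p permutes {1..3}" "q permutes {1..3}" "p' permutes {1..3}" "q' permutes {1..3}"
    and eq: "block_perm (p, q) = block_perm (p', q')"
  have "p x = p' x" for x
    using block_perm_permutes(2)[OF *(1,2), of x] block_perm_permutes(2)[OF *(3,4), of x] eq
      permutes_not_in[OF *(1), of x] permutes_not_in[OF *(3), of x] by metis
  moreover have "q x = q' x" for x
    using block_perm_permutes(3)[OF *(1,2), of x] block_perm_permutes(3)[OF *(3,4), of x] eq
      permutes_not_in[OF *(2), of x] permutes_not_in[OF *(4), of x] by (metis add_right_cancel)
  ultimately show "p = p' \<and> q = q'" by (simp add: fun_eq_iff)
qed

text \<open>
  A permutation that preserves \<open>{1, 2, 3}\<close> also preserves \<open>{4, 5, 6}\<close>, hence is the product of its
  restrictions to the two blocks.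
\<close>

lemma block_perm_image:
  "block_perm ` carrier (sym_group 3 \<times>\<times> sym_group 3) = set_stabilizer {1..6} {1..3}"
proof (intro equalityI subsetI)
  fix r assume "r \<in> block_perm ` carrier (sym_group 3 \<times>\<times> sym_group 3)"
  then obtain p q where "p permutes {1..3}" "q permutes {1..3}" "r = block_perm (p, q)"
    by (auto simp: sym_group_carrier)
  then show "r \<in> set_stabilizer {1..6} {1..3}"
    using block_perm_permutes(1,4)[of p q] by (simp only: set_stabilizer_def mem_Collect_eq simp_thms)
next
  fix r assume "r \<in> set_stabilizer {1..6} {1..3::nat}"
  then have r: "r permutes {1..6}" "r ` {1..3} = {1..3}" by (auto simp: set_stabilizer_def)
  have b: "{1..6} - {1..3} = {4..6::nat}" by auto
  have "r ` {4..6} = {4..6}"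
    using image_set_diff[OF permutes_inj[OF r(1)], of "{1..6}" "{1..3}"] r(2)
      permutes_image[OF r(1)] by (simp only: b)
  then have bij: "bij_betw r {1..3} {1..3}" "bij_betw r {4..6} {4..6}"
    using r(2) permutes_inj_on[OF r(1)] by (simp_all only: bij_betw_def)
  define p where "p = restrict_id r {1..3}"
  define q' where "q' = restrict_id r {4..6}"
  define q where "q = map_permutation {4..6} (\<lambda>k. k - 3) q'"
  have p: "p permutes {1..3}" unfolding p_def by (rule permutes_restrict_id[OF bij(1)])
  have q': "q' permutes {4..6}" unfolding q'_def by (rule permutes_restrict_id[OF bij(2)])
  have unshift: "bij_betw (\<lambda>k::nat. k - 3) {4..6} {1..3}"
    by (rule bij_betw_byWitness[where f' = "\<lambda>k. k + 3"]) auto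
  have q: "q permutes {1..3}"
    unfolding q_def by (rule map_permutation_permutes[OF unshift q'])
  have "map_permutation {1..3} (\<lambda>k. k + 3) q = q'"
    unfolding q_def by (rule map_permutation_compose_inv[OF unshift q']) auto
  then have "block_perm (p, q) = p \<circ> q'" by (simp add: block_perm_def)
  also have "\<dots> = r"
  proof (rule ext)
    fix x :: nat
    consider "x \<in> {1..3}" | "x \<in> {4..6}" | "x \<notin> {1..6}" by force
    then show "(p \<circ> q') x = r x"
    proof cases
      case 1
      then have "x \<notin> {4..6}" by simp
      with 1 show ?thesis by (simp only: p_def q'_def comp_apply restrict_id_simps simp_thms)
    next
      case 2
      then have "r x \<in> {4..6}" by (rule bij_betw_apply[OF bij(2)])
      then have "r x \<notin> {1..3}" by simp
      with 2 show ?thesis by (simp only: p_def q'_def comp_apply restrict_id_simps simp_thms)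
    next
      case 3
      then have "x \<notin> {4..6}" "x \<notin> {1..3}" by auto
      with permutes_not_in[OF r(1) 3] show ?thesis
        by (simp only: p_def q'_def comp_apply restrict_id_simps simp_thms)
    qed
  qed
  finally show "r \<in> block_perm ` carrier (sym_group 3 \<times>\<times> sym_group 3)"
    using p q by (intro image_eqI[of _ _ "(p, q)"]) (simp_all add: sym_group_carrier)
qed

lemma H_r_iso:
  fixes m :: "'n::finite \<Rightarrow> nat"
  shows "perm_act \<delta> \<circ> block_perm \<in> iso (sym_group 3 \<times>\<times> sym_group 3) (H_r \<delta> m)"
proof -
  let ?K = "sym_group 3 \<times>\<times> sym_group 3"
  let ?S = "adjacent 3 \<times> {id} \<union> {id} \<times> adjacent 3"
  let ?f = "perm_act \<delta> \<circ> block_perm :: _ \<Rightarrow> 'n point \<Rightarrow> _"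
  have mid: "map_permutation {1..3} (\<lambda>k::nat. k + 3) id = id"
    by (rule map_permutation_id'[OF shift_inj])
  have mt: "map_permutation {1..3} (\<lambda>k::nat. k + 3) (transpose i j) = transpose (i + 3) (j + 3)"
    if "i \<in> {1..3}" "j \<in> {1..3}" for i j
    using that by (rule map_permutation_transpose[OF shift_inj])
  have y: "block_perm (p, id) = p" for p
    by (simp only: block_perm_def prod.case mid comp_id)
  have "block_perm (id, transpose 1 2) = transpose 4 5" "block_perm (id, transpose 2 3) = transpose 5 6"
    using mt[of 1 2] mt[of 2 3] by (simp_all add: block_perm_def)
  then have "block_perm ` ?S = {transpose 1 2, transpose 2 3, transpose 4 5, transpose 5 6}"
    by (auto simp: adjacent_3 y image_Un)
  then have "?f ` ?S = perm_act \<delta> ` {transpose 1 2, transpose 2 3, transpose 4 5, transpose 5 6}"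
    by (simp only: image_comp[symmetric])
  also have "\<dots> = sigma \<delta> ` {1, 2, 4, 5}"
    by (simp add: sigma_eq_perm_act eval_nat_numeral)
  finally have gens: "?f ` ?S = sigma \<delta> ` {1, 2, 4, 5}" .
  have "?f \<in> iso ?K (subgroup_generated (G_r \<delta> m) (?f ` ?S))"
  proof (rule iso_subgroup_generated_image)
    show "?f \<in> hom ?K (G_r \<delta> m)"
    proof (rule homI; clarsimp simp only: carrier_DirProd mem_Sigma_iff mult_DirProd
        sym_group_carrier sym_group_mult comp_apply)
      fix p q :: "nat \<Rightarrow> nat"
      assume "p permutes {1..3}" "q permutes {1..3}"
      then show "perm_act \<delta> (block_perm (p, q)) \<in> carrier (G_r \<delta> m)"
        unfolding perm_act_eq_group_elt[of \<delta> _ m] by (intro group_elt_in_G_r block_perm_permutes(1)) auto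
    next
      fix p q p' q' :: "nat \<Rightarrow> nat"
      assume *: "p permutes {1..3}" "q permutes {1..3}" "p' permutes {1..3}" "q' permutes {1..3}"
      note y = block_perm_permutes(1)[OF *(1,2)] block_perm_permutes(1)[OF *(3,4)]
      show "(perm_act \<delta> (block_perm (p \<circ> p', q \<circ> q')) :: 'n point \<Rightarrow> _) =
          perm_act \<delta> (block_perm (p, q)) \<otimes>\<^bsub>G_r \<delta> m\<^esub> perm_act \<delta> (block_perm (p', q'))"
        unfolding block_perm_comp[OF *] perm_act_comp[OF y]
        by (rule mult_G_r[symmetric]) (intro bij_perm_act y)+
    qed
    have "inj_on (perm_act \<delta> :: _ \<Rightarrow> 'n point \<Rightarrow> _) (block_perm ` carrier ?K)"
      unfolding block_perm_image
      by (rule inj_onI, rule perm_act_inj) (auto simp: set_stabilizer_def)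
    with block_perm_inj show "inj_on ?f (carrier ?K)" by (rule comp_inj_on)
    show "?S \<subseteq> carrier ?K"
      using adjacent_subset[of 3] by (auto simp: sym_group_carrier)
  qed (simp_all add: DirProd_group sym_group_is_group group_G_r generate_adjacent_DirProd)
  then show ?thesis by (simp only: gens H_r_def)
qed

lemma carrier_H_r: "carrier (H_r \<delta> m) = perm_act \<delta> ` set_stabilizer {1..6} {1..3}"
  using H_r_iso[of \<delta> m] unfolding block_perm_image[symmetric] iso_def bij_betw_def
  by (simp only: mem_Collect_eq image_comp[symmetric])


section \<open>The double cosets and the representatives\<close>

definition coset_cell ::
  "complex \<Rightarrow> ('n \<Rightarrow> nat) \<Rightarrow> nat \<Rightarrow> nat \<Rightarrow> ('n::finite point \<Rightarrow> 'n point) set" where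
  "coset_cell \<delta> m c e = {group_elt \<delta> m p e | p. p permutes {1..6} \<and> crossing {1..3} p = c}"

text \<open>
  Since \<open>\<tau>\<close> is central, its exponent is the same throughout a double coset, and the
  permutation part is governed by \<open>crossing_eq_iff\<close>.
\<close>

lemma double_coset_group_elt:
  fixes m :: "'n::finite \<Rightarrow> nat"
  assumes w: "w permutes {1..6}" and e: "e \<in> {0..1}"
  shows "double_coset (G_r \<delta> m) (carrier (H_r \<delta> m)) (group_elt \<delta> m w e) (carrier (H_r \<delta> m))
    = coset_cell \<delta> m (crossing {1..3} w) e"
proof -
  let ?A = "set_stabilizer {1..6} {1..3::nat}"
  have prod: "perm_act \<delta> h \<otimes>\<^bsub>G_r \<delta> m\<^esub> group_elt \<delta> m w e \<otimes>\<^bsub>G_r \<delta> m\<^esub> perm_act \<delta> k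
      = group_elt \<delta> m (h \<circ> w \<circ> k) e"
    if "h \<in> ?A" "k \<in> ?A" for h k
  proof -
    have hk: "h permutes {1..6}" "k permutes {1..6}" using that by (simp_all add: set_stabilizer_def)
    have hw: "h \<circ> w permutes {1..6}" by (rule permutes_compose[OF w hk(1)])
    have em: "(0 + e) mod 2 = e" "(e + 0) mod 2 = e" "0 \<in> {0..1::nat}" using e by auto
    show ?thesis
      unfolding perm_act_eq_group_elt[of \<delta> _ m] mult_G_r[OF bij_group_elt[OF hk(1)] bij_group_elt[OF w]]
        group_elt_comp[OF hk(1) w em(3) e] em(1) mult_G_r[OF bij_group_elt[OF hw] bij_group_elt[OF hk(2)]]
        group_elt_comp[OF hw hk(2) e em(3)] em(2) ..
  qed
  have "double_coset (G_r \<delta> m) (carrier (H_r \<delta> m)) (group_elt \<delta> m w e) (carrier (H_r \<delta> m))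
      = {group_elt \<delta> m (h \<circ> w \<circ> k) e | h k. h \<in> ?A \<and> k \<in> ?A}"
    unfolding double_coset_def carrier_H_r r_coset_def set_mult_def using prod by fastforce
  also have "\<dots> = coset_cell \<delta> m (crossing {1..3} w) e"
  proof (intro equalityI subsetI)
    fix g assume "g \<in> {group_elt \<delta> m (h \<circ> w \<circ> k) e | h k. h \<in> ?A \<and> k \<in> ?A}"
    then obtain h k where g: "g = group_elt \<delta> m (h \<circ> w \<circ> k) e" and hk: "h \<in> ?A" "k \<in> ?A" by blast
    have "h \<circ> w \<circ> k permutes {1..6}"
      using hk w by (intro permutes_compose) (simp_all only: set_stabilizer_def mem_Collect_eq)
    moreover from this have "crossing {1..3} (h \<circ> w \<circ> k) = crossing {1..3} w"
      using hk by (subst crossing_eq_iff[OF _ _ _ w]) auto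
    ultimately show "g \<in> coset_cell \<delta> m (crossing {1..3} w) e" unfolding g coset_cell_def by blast
  next
    fix g assume "g \<in> coset_cell \<delta> m (crossing {1..3} w) e"
    then obtain p where p: "g = group_elt \<delta> m p e" "p permutes {1..6}"
        "crossing {1..3} p = crossing {1..3} w"
      unfolding coset_cell_def by blast
    have "\<exists>h\<in>?A. \<exists>k\<in>?A. p = h \<circ> w \<circ> k"
      using p(3) by (subst (asm) crossing_eq_iff[OF _ _ p(2) w]) auto
    then show "g \<in> {group_elt \<delta> m (h \<circ> w \<circ> k) e | h k. h \<in> ?A \<and> k \<in> ?A}"
      unfolding p(1) by blast
  qed
  finally show ?thesis .
qed

definition omega_perm :: "nat \<Rightarrow> nat \<Rightarrow> nat" where
  "omega_perm i =
    (let t = (\<lambda>j. transpose j (Suc j)) in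
     if i = 0 then id
     else if i = 1 then t 3
     else if i = 2 then t 3 \<circ> t 4 \<circ> t 2 \<circ> t 3
     else t 3 \<circ> t 4 \<circ> t 5 \<circ> t 2 \<circ> t 1 \<circ> t 3 \<circ> t 4 \<circ> t 2 \<circ> t 3)"

lemma omega_perm_permutes: "omega_perm i permutes {1..6}"
  unfolding omega_perm_def Let_def
  by (auto intro!: permutes_compose permutes_swap_id)

lemma le_3_cases: "i \<in> {0..3::nat} \<longleftrightarrow> i = 0 \<or> i = 1 \<or> i = 2 \<or> i = 3"
  by auto

lemma crossing_omega_perm:
  assumes "i \<in> {0..3}"
  shows "crossing {1..3} (omega_perm i) = i"
proof -
  have "{1..3::nat} = {1, 2, 3}" by auto
  then show ?thesis
    using assms unfolding le_3_cases
    by (elim disjE) (simp_all add: crossing_def omega_perm_def Let_def transpose_def)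
qed

lemma omega_eq_perm_act:
  assumes "i \<in> {0..3}"
  shows "(omega \<delta> i :: 'n::finite point \<Rightarrow> _) = perm_act \<delta> (omega_perm i)"
proof -
  have t: "transpose j (Suc j) permutes {1..6}" if "j \<in> {1..5}" for j
    using that by (intro permutes_swap_id) auto
  have step: "perm_act \<delta> (transpose j (Suc j) \<circ> p) = sigma \<delta> j \<circ> perm_act \<delta> p"
    if "j \<in> {1..5}" "p permutes {1..6}" for j p
    by (simp only: sigma_eq_perm_act[OF that(1)] perm_act_comp[OF t[OF that(1)] that(2)])
  have m: "1 \<in> {1..5::nat}" "2 \<in> {1..5::nat}" "3 \<in> {1..5::nat}" "4 \<in> {1..5::nat}" "5 \<in> {1..5::nat}"
    by auto
  note simps = comp_assoc step t m permutes_compose sigma_eq_perm_act[OF m(3)]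
  have "omega_perm 0 = id" "omega_perm 1 = transpose 3 (Suc 3)"
    "omega_perm 2 = transpose 3 (Suc 3) \<circ> transpose 4 (Suc 4) \<circ> transpose 2 (Suc 2) \<circ>
      transpose 3 (Suc 3)"
    "omega_perm 3 = transpose 3 (Suc 3) \<circ> transpose 4 (Suc 4) \<circ> transpose 5 (Suc 5) \<circ>
      transpose 2 (Suc 2) \<circ> transpose 1 (Suc 1) \<circ> transpose 3 (Suc 3) \<circ> transpose 4 (Suc 4) \<circ>
      transpose 2 (Suc 2) \<circ> transpose 3 (Suc 3)"
    unfolding omega_perm_def Let_def by simp_all
  moreover have "omega \<delta> 0 = (id :: 'n point \<Rightarrow> _)" "omega \<delta> 1 = (sigma \<delta> 3 :: 'n point \<Rightarrow> _)"
    "omega \<delta> 2 = (sigma \<delta> 3 \<circ> sigma \<delta> 4 \<circ> sigma \<delta> 2 \<circ> sigma \<delta> 3 :: 'n point \<Rightarrow> _)"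
    "omega \<delta> 3 = (sigma \<delta> 3 \<circ> sigma \<delta> 4 \<circ> sigma \<delta> 5 \<circ> sigma \<delta> 2 \<circ> sigma \<delta> 1 \<circ>
       sigma \<delta> 3 \<circ> sigma \<delta> 4 \<circ> sigma \<delta> 2 \<circ> sigma \<delta> 3 :: 'n point \<Rightarrow> _)"
    by (simp_all add: omega_def)
  ultimately show ?thesis
    using assms unfolding le_3_cases
    by (elim disjE) (simp_all only: simps perm_act_id)
qed

text \<open>
  The set indexed by \<open>(c, e)\<close> is nonempty, as it contains the element built from \<open>omega_perm c\<close>,
  and each element of the group determines both its crossing number and its exponent.
\<close>

lemma coset_cell_inj:
  assumes "c \<in> {0..3}" "e \<in> {0..1}" "f \<in> {0..1}" "coset_cell \<delta> m c e = coset_cell \<delta> m d f"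
  shows "c = d" "e = f"
proof -
  have "group_elt \<delta> m (omega_perm c) e \<in> coset_cell \<delta> m c e"
    unfolding coset_cell_def using omega_perm_permutes crossing_omega_perm[OF assms(1)] by blast
  then have "group_elt \<delta> m (omega_perm c) e \<in> coset_cell \<delta> m d f" by (simp only: assms(4))
  then obtain p where p: "group_elt \<delta> m (omega_perm c) e = group_elt \<delta> m p f" "p permutes {1..6}"
      "crossing {1..3} p = d"
    unfolding coset_cell_def by blast
  from group_elt_inj[OF omega_perm_permutes p(2) assms(2,3) p(1)] p(3) crossing_omega_perm[OF assms(1)]
  show "c = d" "e = f" by simp_all
qed

lemma double_coset_omega:
  assumes "i \<in> {0..3}" "e \<in> {0..1}"
  shows "double_coset (G_r \<delta> m) (carrier (H_r \<delta> m)) (omega \<delta> i \<circ> (tau \<delta> m ^^ e))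
      (carrier (H_r \<delta> m)) = coset_cell \<delta> m i e"
  using double_coset_group_elt[OF omega_perm_permutes[of i] assms(2), of \<delta> m]
  by (simp only: group_elt_def omega_eq_perm_act[OF assms(1)] crossing_omega_perm[OF assms(1)])

lemma crossing_le_3: "crossing {1..3::nat} p \<in> {0..3}"
proof -
  have "card (p ` {1..3} - {1..3}) \<le> card (p ` {1..3})" by (rule card_mono) auto
  also have "\<dots> \<le> 3" using card_image_le[of "{1..3::nat}" p] by simp
  finally show ?thesis by (simp add: crossing_def)
qed

lemma double_cosets_eq:
  fixes m :: "'n::finite \<Rightarrow> nat"
  shows "double_cosets (G_r \<delta> m) (carrier (H_r \<delta> m)) (carrier (H_r \<delta> m))
    = (\<lambda>(i, e). coset_cell \<delta> m i e) ` ({0..3} \<times> {0..1})" (is "?D = ?C")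
proof (intro equalityI subsetI)
  fix D assume "D \<in> ?D"
  then obtain w e where "w permutes {1..6}" "e \<in> {0..1}"
      "D = double_coset (G_r \<delta> m) (carrier (H_r \<delta> m)) (group_elt \<delta> m w e) (carrier (H_r \<delta> m))"
    unfolding double_cosets_def carrier_G_r by blast
  then show "D \<in> ?C"
    using double_coset_group_elt[of w e \<delta> m] crossing_le_3[of w]
    by (intro image_eqI[of _ _ "(crossing {1..3} w, e)"]) (simp_all only: prod.case mem_Sigma_iff simp_thms)
next
  fix D assume "D \<in> ?C"
  then obtain i e where ie: "i \<in> {0..3}" "e \<in> {0..1}" "D = coset_cell \<delta> m i e" by blast
  have "D = double_coset (G_r \<delta> m) (carrier (H_r \<delta> m)) (group_elt \<delta> m (omega_perm i) e) (carrier (H_r \<delta> m))"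
    by (simp only: ie(3) double_coset_group_elt[OF omega_perm_permutes ie(2)] crossing_omega_perm[OF ie(1)])
  then show "D \<in> ?D"
    unfolding double_cosets_def using group_elt_in_G_r[OF omega_perm_permutes ie(2)] by blast
qed

lemma carrier_generated_tau:
  fixes m :: "'n::finite \<Rightarrow> nat"
  shows "carrier (subgroup_generated (G_r \<delta> m) {tau \<delta> m}) = {group_elt \<delta> m id e | e. e \<in> {0..1}}"
proof -
  interpret group "G_r \<delta> m" by (rule group_G_r)
  let ?T = "{group_elt \<delta> m id e | e. e \<in> {0..1}}"
  have tau: "tau \<delta> m = group_elt \<delta> m id 1"
    by (simp only: group_elt_def perm_act_id funpow.simps One_nat_def id_comp comp_id)
  have one: "\<one>\<^bsub>G_r \<delta> m\<^esub> = group_elt \<delta> m id 0"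
    by (simp only: G_r_def one_subgroup_generated BijGroup_UNIV group_elt_def perm_act_id funpow.simps id_comp)
  have T: "?T = {group_elt \<delta> m id 0, group_elt \<delta> m id 1}" by (auto simp: le_Suc_eq)
  have mult: "group_elt \<delta> m id e \<otimes>\<^bsub>G_r \<delta> m\<^esub> group_elt \<delta> m id f = group_elt \<delta> m id ((e + f) mod 2)"
    if "e \<in> {0..1}" "f \<in> {0..1}" for e f
    by (simp only: mult_G_r bij_group_elt permutes_id group_elt_comp[OF permutes_id permutes_id that] id_comp)
  have sub: "group_elt \<delta> m id e \<in> carrier (G_r \<delta> m)" if "e \<in> {0..1}" for e
    by (rule group_elt_in_G_r[OF permutes_id that])
  have "subgroup ?T (G_r \<delta> m)"
  proof (rule subgroupI)
    show "?T \<subseteq> carrier (G_r \<delta> m)" using sub by blast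
    show "?T \<noteq> {}" unfolding T by blast
    fix g assume "g \<in> ?T"
    then obtain e where e: "g = group_elt \<delta> m id e" "e \<in> {0..1}" by blast
    have "e = 0 \<or> e = 1" using e(2) by auto
    then have "(e + e) mod 2 = 0" by (elim disjE) simp_all
    then have "g \<otimes>\<^bsub>G_r \<delta> m\<^esub> g = \<one>\<^bsub>G_r \<delta> m\<^esub>" unfolding e(1) one mult[OF e(2) e(2)] by simp
    then have "inv\<^bsub>G_r \<delta> m\<^esub> g = g"
      using sub[OF e(2)] sub[OF e(2)] unfolding e(1) by (rule inv_equality)
    then show "inv\<^bsub>G_r \<delta> m\<^esub> g \<in> ?T" using \<open>g \<in> ?T\<close> by simp
  next
    fix g h assume "g \<in> ?T" "h \<in> ?T"
    then obtain e f where "g = group_elt \<delta> m id e" "e \<in> {0..1}" "h = group_elt \<delta> m id f" "f \<in> {0..1}" by blast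
    moreover have "(e + f) mod 2 \<in> {0..1}" by (simp add: less_Suc_eq_le[symmetric])
    ultimately show "g \<otimes>\<^bsub>G_r \<delta> m\<^esub> h \<in> ?T" using mult by blast
  qed
  then have "carrier (subgroup_generated (G_r \<delta> m) {tau \<delta> m}) \<subseteq> ?T"
    by (rule subgroup_generated_minimal) (auto simp: tau)
  moreover have "\<one>\<^bsub>G_r \<delta> m\<^esub> \<in> carrier (subgroup_generated (G_r \<delta> m) {tau \<delta> m})"
    unfolding carrier_subgroup_generated by (rule generate.one)
  moreover have "tau \<delta> m \<in> carrier (subgroup_generated (G_r \<delta> m) {tau \<delta> m})"
    unfolding carrier_subgroup_generated using sub[of 1] by (intro generate.incl) (simp add: tau)
  ultimately show ?thesis unfolding T unfolding one tau by blast
qed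

text \<open>
  Multiplication by \<open>\<tau>\<close> keeps the permutation part and toggles the exponent.
\<close>

lemma tau_orbit_cell:
  fixes m :: "'n::finite \<Rightarrow> nat"
  assumes e: "e \<in> {0..1}"
  shows "tau_orbit \<delta> m (coset_cell \<delta> m i e) = coset_cell \<delta> m i ` {0..1}"
proof -
  have shift: "group_elt \<delta> m id f <#\<^bsub>G_r \<delta> m\<^esub> coset_cell \<delta> m i e = coset_cell \<delta> m i ((f + e) mod 2)"
    if f: "f \<in> {0..1}" for f
  proof -
    have "group_elt \<delta> m id f \<otimes>\<^bsub>G_r \<delta> m\<^esub> group_elt \<delta> m p e = group_elt \<delta> m p ((f + e) mod 2)"
      if "p permutes {1..6}" for p
      by (simp only: mult_G_r bij_group_elt permutes_id that group_elt_comp[OF permutes_id that f e] id_comp)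
    then show ?thesis unfolding l_coset_def coset_cell_def by auto
  qed
  have "tau_orbit \<delta> m (coset_cell \<delta> m i e) = {coset_cell \<delta> m i ((f + e) mod 2) | f. f \<in> {0..1}}"
    unfolding tau_orbit_def orbit_def carrier_generated_tau using shift by blast
  also have "\<dots> = coset_cell \<delta> m i ` ((\<lambda>f. (f + e) mod 2) ` {0..1})" by blast
  also have "(\<lambda>f. (f + e) mod 2) ` {0..1} = {0..1}"
  proof -
    have "{0..1::nat} = {0, 1}" by auto
    moreover have "e = 0 \<or> e = 1" using e by auto
    ultimately show ?thesis by (elim disjE) auto
  qed
  finally show ?thesis .
qed

theorem mainTheorem11:
  fixes \<delta> :: complex and m :: "'n::finite \<Rightarrow> nat"
  assumes "CARD('n) \<ge> 2"
  shows
    "G_r \<delta> m \<cong> sym_group 6 \<times>\<times> sym_group 2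
     \<and> subgroup (carrier (H_r \<delta> m)) (G_r \<delta> m)
     \<and> H_r \<delta> m \<cong> sym_group 3 \<times>\<times> sym_group 3
     \<and> (omega \<delta> 2 :: 'n point \<Rightarrow> 'n point) = sigma \<delta> 3 \<circ> sigma \<delta> 4 \<circ> sigma \<delta> 2 \<circ> omega \<delta> 1
     \<and> (omega \<delta> 3 :: 'n point \<Rightarrow> 'n point) =
         sigma \<delta> 3 \<circ> sigma \<delta> 4 \<circ> sigma \<delta> 5 \<circ> sigma \<delta> 2 \<circ> sigma \<delta> 1 \<circ> omega \<delta> 2
     \<and> (\<forall>i\<in>{0..3}. omega \<delta> i \<in> carrier (G_r \<delta> m))
     \<and> bij_betw
         (\<lambda>i. tau_orbit \<delta> m
            (double_coset (G_r \<delta> m) (carrier (H_r \<delta> m)) (omega \<delta> i) (carrier (H_r \<delta> m))))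
         {0..3}
         (tau_orbits \<delta> m)
     \<and> bij_betw
         (\<lambda>(i, e). double_coset (G_r \<delta> m) (carrier (H_r \<delta> m))
            (omega \<delta> i \<circ> (tau \<delta> m ^^ e)) (carrier (H_r \<delta> m)))
         ({0..3} \<times> {0..1})
         (double_cosets (G_r \<delta> m) (carrier (H_r \<delta> m)) (carrier (H_r \<delta> m)))
     \<and> (\<forall>i\<in>{1..5}. tau \<delta> m \<circ> sigma \<delta> i = sigma \<delta> i \<circ> tau \<delta> m)
     \<and> (\<forall>i\<in>{0..3}. tau \<delta> m \<circ> omega \<delta> i = omega \<delta> i \<circ> tau \<delta> m)"
proof (intro conjI ballI)
  have groups: "group (sym_group k \<times>\<times> sym_group l)" for k l
    by (simp add: DirProd_group sym_group_is_group)
  show "G_r \<delta> m \<cong> sym_group 6 \<times>\<times> sym_group 2"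
    using is_isoI[OF G_r_iso] by (rule group.iso_sym[OF groups])
  show "H_r \<delta> m \<cong> sym_group 3 \<times>\<times> sym_group 3"
    using is_isoI[OF H_r_iso] by (rule group.iso_sym[OF groups])
  show "subgroup (carrier (H_r \<delta> m)) (G_r \<delta> m)"
    unfolding H_r_def by (rule group.subgroup_subgroup_generated[OF group_G_r])
  show "(omega \<delta> 2 :: 'n point \<Rightarrow> 'n point) = sigma \<delta> 3 \<circ> sigma \<delta> 4 \<circ> sigma \<delta> 2 \<circ> omega \<delta> 1"
    "(omega \<delta> 3 :: 'n point \<Rightarrow> 'n point) =
       sigma \<delta> 3 \<circ> sigma \<delta> 4 \<circ> sigma \<delta> 5 \<circ> sigma \<delta> 2 \<circ> sigma \<delta> 1 \<circ> omega \<delta> 2"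
    by (simp_all add: omega_def comp_assoc)
  show "omega \<delta> i \<in> carrier (G_r \<delta> m)" if "i \<in> {0..3}" for i
    unfolding omega_eq_perm_act[OF that] perm_act_eq_group_elt[of \<delta> _ m]
    by (rule group_elt_in_G_r[OF omega_perm_permutes]) simp
  show "tau \<delta> m \<circ> sigma \<delta> i = sigma \<delta> i \<circ> tau \<delta> m" if "i \<in> {1..5}" for i
    unfolding sigma_eq_perm_act[OF that]
    by (rule tau_perm_act) (use that in \<open>auto intro!: permutes_swap_id\<close>)
  show "tau \<delta> m \<circ> omega \<delta> i = omega \<delta> i \<circ> tau \<delta> m" if "i \<in> {0..3}" for i
    unfolding omega_eq_perm_act[OF that] by (rule tau_perm_act[OF omega_perm_permutes])
  let ?H = "carrier (H_r \<delta> m)"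
  have "bij_betw (\<lambda>(i, e). coset_cell \<delta> m i e) ({0..3} \<times> {0..1}) (double_cosets (G_r \<delta> m) ?H ?H)"
    unfolding double_cosets_eq
    by (rule inj_on_imp_bij_betw, rule inj_onI) (auto dest: coset_cell_inj)
  then show "bij_betw (\<lambda>(i, e). double_coset (G_r \<delta> m) ?H (omega \<delta> i \<circ> (tau \<delta> m ^^ e)) ?H)
      ({0..3} \<times> {0..1}) (double_cosets (G_r \<delta> m) ?H ?H)"
    by (rule bij_betw_cong[THEN iffD1, rotated]) (auto simp only: double_coset_omega prod.case mem_Sigma_iff)
  have orb: "tau_orbit \<delta> m (double_coset (G_r \<delta> m) ?H (omega \<delta> i) ?H) = coset_cell \<delta> m i ` {0..1}"
    if "i \<in> {0..3}" for i
    using double_coset_omega[OF that, of 0 \<delta> m] tau_orbit_cell[of 0 \<delta> m i] by (simp add: comp_def)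
  have "tau_orbits \<delta> m = tau_orbit \<delta> m ` double_cosets (G_r \<delta> m) ?H ?H"
    unfolding tau_orbits_def tau_orbit_def orbits_def by blast
  also have "\<dots> = (\<lambda>(i, e). tau_orbit \<delta> m (coset_cell \<delta> m i e)) ` ({0..3} \<times> {0..1})"
    unfolding double_cosets_eq image_image by (rule image_cong) auto
  also have "\<dots> = (\<lambda>(i, e). coset_cell \<delta> m i ` {0..1}) ` ({0..3} \<times> {0..1::nat})"
    by (rule image_cong) (auto simp only: tau_orbit_cell prod.case mem_Sigma_iff)
  also have "\<dots> = (\<lambda>i. coset_cell \<delta> m i ` {0..1}) ` {0..3}" by force
  finally have orbits: "tau_orbits \<delta> m = (\<lambda>i. coset_cell \<delta> m i ` {0..1}) ` {0..3}" .
  have "inj_on (\<lambda>i. coset_cell \<delta> m i ` {0..1}) {0..3}"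
  proof (rule inj_onI)
    fix i j :: nat
    assume i: "i \<in> {0..3}" and "j \<in> {0..3}" and eq: "coset_cell \<delta> m i ` {0..1} = coset_cell \<delta> m j ` {0..1}"
    have "coset_cell \<delta> m i 0 \<in> coset_cell \<delta> m j ` {0..1}" unfolding eq[symmetric] by simp
    then obtain f where "f \<in> {0..1}" "coset_cell \<delta> m i 0 = coset_cell \<delta> m j f" by blast
    then show "i = j" using coset_cell_inj(1)[OF i, of 0 f] by simp
  qed
  then have "bij_betw (\<lambda>i. coset_cell \<delta> m i ` {0..1}) {0..3} (tau_orbits \<delta> m)"
    unfolding orbits by (rule inj_on_imp_bij_betw)
  then show "bij_betw (\<lambda>i. tau_orbit \<delta> m (double_coset (G_r \<delta> m) ?H (omega \<delta> i) ?H)) {0..3}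
      (tau_orbits \<delta> m)"
    by (rule bij_betw_cong[THEN iffD1, rotated]) (simp only: orb)
qed

end
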